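(* Let $(X,\mathscr{R})$ be a symmetric association scheme with $n$ classes which is $Q$-polynomial with respect to the ordering $E_0,E_1,\dots,E_n$ of its primitive idempotents, and fix a base vertex $x\in X$. Let $(Y,\omega)$ be a relative $t$-design (with respect to $x$) supported on $\bigsqcup_{\ell\in L}X_\ell$. Then for every $\ell\in L$, the weighted subset $(Y\cap X_\ell,E_\ell^*\omega)$ is a relative $(t-|L|+1)$-design.
   Context: A (symmetric) association scheme with $n$ classes is a finite set $X$ with a partition $X^2=R_0\sqcup\cdots\sqcup R_n$ into nonempty symmetric relations, $R_0$ the diagonal, such that for all $i,j,k$ and $(y,z)\in R_k$ the number of $w$ with $(y,w)\in R_i$, $(w,z)\in R_j$ depends only on $i,j,k$. With $A_i$ the adjacency matrix of $R_i$, $\operatorname{span}\{A_i\}$ is a commutative algebra with primitive idempotents $E_0=|X|^{-1}J,E_1,\dots,E_n$. The scheme is $Q$-polynomial w.r.t. this ordering if there are reals $a_i^*,b_i^*,c_i^*$ with $b_n^*=c_0^*=0$, $b_{i-1}^*c_i^*\ne0$ ($1\le i\le n$) and $E_1\circ E_i=|X|^{-1}(b_{i-1}^*E_{i-1}+a_i^*E_i+c_{i+1}^*E_{i+1})$ for $0\le i\le n$ ($\circ$ the entrywise product, $E_{-1}=E_{n+1}=O$). Let $V=\mathbb{C}^X$. For the base vertex $x$, $X_i=\{y:(x,y)\in R_i\}$ (shells), $E_i^*$ is the diagonal 0/1 matrix with $(E_i^* )_{y,y}=1$ iff $y\in X_i$, and $\hat x$ is the characteristic vector of $x$. A weighted subset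 is a pair $(Y,\omega)$ with $\omega:X\to[0,\infty)$ regarded as a vector in $V$ and $Y=\{y:\omega(y)>0\}$; it is supported on $\bigsqcup_{\ell\in L}X_\ell$ where $L=\{\ell:Y\cap X_\ell\neq\emptyset\}$. It is a relative $t$-design (w.r.t. $x$) if $E_i\omega\in\operatorname{span}\{E_i\hat x\}$ for $1\le i\le t$. *)

theory Defs
  imports "HOL-Analysis.Analysis"
begin

text \<open>The point set $X$ is the universe of a finite type \<open>'v\<close>; relations are indexed by
  \<open>0..n\<close>, and the values \<open>R i\<close> and \<open>E i\<close> at indices \<open>i > n\<close> are never looked at.\<close>

definition symmetric_scheme :: "nat \<Rightarrow> (nat \<Rightarrow> ('v::finite \<times> 'v) set) \<Rightarrow> bool" where
  "symmetric_scheme n R \<longleftrightarrow>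
     R 0 = Id \<and>
     (\<forall>i\<le>n. R i \<noteq> {} \<and> sym (R i)) \<and>
     disjoint_family_on R {..n} \<and>
     (\<Union>i\<le>n. R i) = UNIV \<and>
     (\<exists>p :: nat \<Rightarrow> nat \<Rightarrow> nat \<Rightarrow> nat. \<forall>i\<le>n. \<forall>j\<le>n. \<forall>k\<le>n. \<forall>(y, z) \<in> R k.
        card {w. (y, w) \<in> R i \<and> (w, z) \<in> R j} = p i j k)"

definition adjacency_matrix :: "('v::finite \<times> 'v) set \<Rightarrow> complex^'v^'v" where
  "adjacency_matrix S = (\<chi> y z. if (y, z) \<in> S then 1 else 0)"

text \<open>Complex scalar multiples of matrices: the library's \<open>*\<^sub>R\<close> has only real scalars, and \<open>*s\<close>
  at a matrix type would take row vectors as scalars.\<close>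

definition matrix_scale :: "complex \<Rightarrow> complex^'v^'v \<Rightarrow> complex^'v^'v" (infixr "*\<^sub>m" 75) where
  "c *\<^sub>m M = (\<chi> y z. c * M $ y $ z)"

definition entrywise_product :: "complex^'v^'v \<Rightarrow> complex^'v^'v \<Rightarrow> complex^'v^'v"
    (infixl "\<circ>\<^sub>m" 70) where
  "M \<circ>\<^sub>m N = (\<chi> y z. M $ y $ z * N $ y $ z)"

definition adjacency_algebra :: "nat \<Rightarrow> (nat \<Rightarrow> ('v::finite \<times> 'v) set) \<Rightarrow> (complex^'v^'v) set" where
  "adjacency_algebra n R = range (\<lambda>c. \<Sum>i\<le>n. c i *\<^sub>m adjacency_matrix (R i))"

definition primitive_idempotent :: "(complex^'v^'v) set \<Rightarrow> complex^'v^'v \<Rightarrow> bool" where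
  "primitive_idempotent \<A> e \<longleftrightarrow>
     e \<in> \<A> \<and> e \<noteq> 0 \<and> e ** e = e \<and>
     \<not> (\<exists>f\<in>\<A>. \<exists>g\<in>\<A>. f \<noteq> 0 \<and> g \<noteq> 0 \<and> f ** f = f \<and> g ** g = g \<and>
          f ** g = 0 \<and> g ** f = 0 \<and> e = f + g)"

definition idempotent_ordering ::
    "nat \<Rightarrow> (nat \<Rightarrow> ('v::finite \<times> 'v) set) \<Rightarrow> (nat \<Rightarrow> complex^'v^'v) \<Rightarrow> bool" where
  "idempotent_ordering n R E \<longleftrightarrow>
     bij_betw E {..n} {e. primitive_idempotent (adjacency_algebra n R) e} \<and>
     E 0 = (1 / of_nat CARD('v)) *\<^sub>m (\<chi> y z. 1)"

text \<open>The convention $E_{-1} = E_{n+1} = O$.\<close>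

definition extended_idempotent :: "nat \<Rightarrow> (nat \<Rightarrow> complex^'v^'v) \<Rightarrow> int \<Rightarrow> complex^'v^'v" where
  "extended_idempotent n E i = (if 0 \<le> i \<and> i \<le> int n then E (nat i) else 0)"

definition Q_polynomial :: "nat \<Rightarrow> (nat \<Rightarrow> complex^'v::finite^'v) \<Rightarrow> bool" where
  "Q_polynomial n E \<longleftrightarrow>
     (let F = extended_idempotent n E in
      \<exists>a b c :: int \<Rightarrow> real.
        b (int n) = 0 \<and> c 0 = 0 \<and>
        (\<forall>i\<in>{1..int n}. b (i - 1) * c i \<noteq> 0) \<and>
        (\<forall>i\<in>{0..int n}. F 1 \<circ>\<^sub>m F i =
           (1 / of_nat CARD('v)) *\<^sub>m
             (of_real (b (i - 1)) *\<^sub>m F (i - 1) + of_real (a i) *\<^sub>m F i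
              + of_real (c (i + 1)) *\<^sub>m F (i + 1))))"

definition shell :: "(nat \<Rightarrow> ('v \<times> 'v) set) \<Rightarrow> 'v \<Rightarrow> nat \<Rightarrow> 'v set" where
  "shell R x i = {y. (x, y) \<in> R i}"

definition dual_idempotent :: "(nat \<Rightarrow> ('v::finite \<times> 'v) set) \<Rightarrow> 'v \<Rightarrow> nat \<Rightarrow> complex^'v^'v" where
  "dual_idempotent R x i = (\<chi> y z. if y = z \<and> y \<in> shell R x i then 1 else 0)"

text \<open>A weight function is stored as a vector of $\mathbb{C}^X$ all of whose entries are
  nonnegative reals.\<close>

definition weighted_subset :: "'v::finite set \<Rightarrow> complex^'v \<Rightarrow> bool" where
  "weighted_subset Y \<omega> \<longleftrightarrow> (\<forall>y. \<omega> $ y \<in> nonneg_Reals) \<and> Y = {y. Re (\<omega> $ y) > 0}"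

definition supporting_shells ::
    "nat \<Rightarrow> (nat \<Rightarrow> ('v \<times> 'v) set) \<Rightarrow> 'v \<Rightarrow> 'v set \<Rightarrow> nat set" where
  "supporting_shells n R x Y = {l. l \<le> n \<and> Y \<inter> shell R x l \<noteq> {}}"

text \<open>The strength \<open>t\<close> is an integer, so that it may be a difference; for \<open>t \<le> 0\<close> the span
  condition is empty. Here \<open>axis x 1\<close> is $\hat x$, and \<open>vec.span\<close> is the span over the complex
  numbers (plain \<open>span\<close> would be over the reals).\<close>

definition relative_design ::
    "nat \<Rightarrow> (nat \<Rightarrow> complex^'v^'v) \<Rightarrow> 'v::finite \<Rightarrow> int \<Rightarrow> 'v set \<Rightarrow> complex^'v \<Rightarrow> bool" where
  "relative_design n E x t Y \<omega> \<longleftrightarrow>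
     weighted_subset Y \<omega> \<and>
     (\<forall>i\<in>{1..n}. int i \<le> t \<longrightarrow> E i *v \<omega> \<in> vec.span {E i *v axis x 1})"

end

theory Submission
  imports Defs
begin

text \<open>Let \<open>D\<close> be multiplication by \<open>y \<mapsto> E 1 $ x $ y\<close>, the dual adjacency matrix up to a factor.
  The three-term recurrence gives \<open>E i D E j = 0\<close> for \<open>\<bar>i - j\<bar> > 1\<close>, and \<open>D E j\<close> sends
  $\hat x$ to \<open>(E 1 \<circ>\<^sub>m E j) *v axis x 1\<close>, which stays in the adjacency algebra applied to
  $\hat x$. Hence multiplying a relative \<open>s\<close>-design by \<open>D - \<theta>\<close> leaves the span conditions up to
  \<open>s - 1\<close> intact. The recurrence also shows that \<open>E 1 $ x $ y\<close> takes different values on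
  different shells, so on the support the projection to one shell is a polynomial in \<open>D\<close> of
  degree \<open>card L - 1\<close>.\<close>

section \<open>Complex matrix arithmetic\<close>

text \<open>Provides complex \<open>mat.span\<close> and \<open>mat.independent\<close> for the
  dimension count in \<open>E_spans\<close>.\<close>

interpretation mat: vector_space "matrix_scale :: complex \<Rightarrow> complex^'v::finite^'v \<Rightarrow> complex^'v^'v"
  by unfold_locales (auto simp: matrix_scale_def vec_eq_iff algebra_simps)

lemma matrix_scale_nth [simp]: "(c *\<^sub>m M) $ y $ z = c * M $ y $ z"
  by (simp add: matrix_scale_def)

lemma entrywise_product_nth [simp]: "(M \<circ>\<^sub>m N) $ y $ z = M $ y $ z * N $ y $ z"
  by (simp add: entrywise_product_def)

lemma adjacency_matrix_nth [simp]:
  "adjacency_matrix S $ y $ z = (if (y, z) \<in> S then 1 else 0)"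
  by (simp add: adjacency_matrix_def)

lemma matrix_mult_nth: "(M ** N) $ y $ z = (\<Sum>w\<in>UNIV. M $ y $ w * N $ w $ z)"
  by (simp add: matrix_matrix_mult_def)

lemma matrix_scale_mult_left:
  fixes M N :: "complex^'v::finite^'v"
  shows "(c *\<^sub>m M) ** N = c *\<^sub>m (M ** N)"
  by (simp add: vec_eq_iff matrix_mult_nth sum_distrib_left mult.assoc)

lemma matrix_scale_mult_right:
  fixes M N :: "complex^'v::finite^'v"
  shows "M ** (c *\<^sub>m N) = c *\<^sub>m (M ** N)"
  by (simp add: vec_eq_iff matrix_mult_nth sum_distrib_left algebra_simps)

lemma matrix_scale_vector:
  fixes M :: "complex^'v::finite^'v"
  shows "(c *\<^sub>m M) *v v = c *s (M *v v)"
  by (simp add: vec_eq_iff matrix_vector_mult_def sum_distrib_left mult.assoc)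

lemma matrix_mult_sum_right:
  fixes M :: "complex^'v::finite^'v"
  shows "M ** (\<Sum>i\<in>I. N i) = (\<Sum>i\<in>I. M ** N i)"
  by (induction I rule: infinite_finite_induct)
     (simp_all add: matrix_add_ldistrib)

lemma matrix_add_rdistrib:
  fixes M N P :: "complex^'v::finite^'v"
  shows "(M + N) ** P = M ** P + N ** P"
  by (simp add: vec_eq_iff matrix_mult_nth distrib_right sum.distrib)

lemma matrix_diff_ldistrib:
  fixes M N P :: "complex^'v::finite^'v"
  shows "M ** (N - P) = M ** N - M ** P"
  by (simp add: vec_eq_iff matrix_mult_nth algebra_simps sum_subtractf)

lemma matrix_diff_rdistrib:
  fixes M N P :: "complex^'v::finite^'v"
  shows "(M - N) ** P = M ** P - N ** P"
  by (simp add: vec_eq_iff matrix_mult_nth algebra_simps sum_subtractf)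

lemma sum_matrix_vector:
  fixes N :: "'i \<Rightarrow> complex^'v::finite^'v"
  shows "(\<Sum>i\<in>I. N i) *v v = (\<Sum>i\<in>I. N i *v v)"
  by (induction I rule: infinite_finite_induct)
     (simp_all add: matrix_vector_mult_add_rdistrib)

text \<open>Used in \<open>triple_product_zero\<close>: with the two inner indices moved outside,
  the other three sums collapse by idempotence.\<close>

lemma sum_rotate5:
  "(\<Sum>x\<in>A. \<Sum>y\<in>B. \<Sum>z\<in>C. \<Sum>w\<in>D. \<Sum>u\<in>F. f x y z w u)
   = (\<Sum>w\<in>D. \<Sum>u\<in>F. \<Sum>x\<in>A. \<Sum>y\<in>B. \<Sum>z\<in>C. f x y z w u)"
  unfolding sum.cartesian_product
  by (rule sum.reindex_bij_witness[of _ "\<lambda>(w, u, x, y, z). (x, y, z, w, u)"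
        "\<lambda>(x, y, z, w, u). (w, u, x, y, z)"]) auto

definition conj_matrix :: "complex^'v^'v \<Rightarrow> complex^'v^'v" where
  "conj_matrix M = (\<chi> y z. cnj (M $ y $ z))"

lemma conj_matrix_nth [simp]: "conj_matrix M $ y $ z = cnj (M $ y $ z)"
  by (simp add: conj_matrix_def)

lemma conj_matrix_mult:
  "conj_matrix (M ** N) = conj_matrix M ** conj_matrix (N :: complex^'v::finite^'v)"
  by (simp add: vec_eq_iff matrix_mult_nth)

lemma conj_matrix_conj_matrix [simp]: "conj_matrix (conj_matrix M) = M"
  by (simp add: vec_eq_iff)

text \<open>The action of a diagonal matrix, kept as an operation on vectors so that products of
  such matrices are pointwise products of functions.\<close>

definition diag_mult :: "('v \<Rightarrow> complex) \<Rightarrow> complex^'v \<Rightarrow> complex^'v" where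
  "diag_mult f v = (\<chi> y. f y * v $ y)"

lemma diag_mult_nth [simp]: "diag_mult f v $ y = f y * v $ y"
  by (simp add: diag_mult_def)

lemma dual_idempotent_nth:
  "(dual_idempotent R x l *v v) $ y = (if y \<in> shell R x l then v $ y else 0)"
proof -
  have "(dual_idempotent R x l *v v) $ y
      = (\<Sum>z\<in>UNIV. if y = z then (if y \<in> shell R x l then v $ z else 0) else 0)"
    unfolding dual_idempotent_def matrix_vector_mult_def
    by (simp only: vec_lambda_beta) (rule sum.cong[OF refl], simp)
  then show ?thesis by simp
qed

section \<open>The adjacency algebra\<close>

locale idempotent_ordered_scheme =
  fixes n :: nat
    and R :: "nat \<Rightarrow> ('v::finite \<times> 'v) set"
    and E :: "nat \<Rightarrow> complex^'v^'v"
  assumes scheme: "symmetric_scheme n R"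
    and ordering: "idempotent_ordering n R E"
begin

abbreviation \<A> :: "(complex^'v^'v) set" where
  "\<A> \<equiv> adjacency_algebra n R"

lemma ex_relation: "\<exists>k\<le>n. (y, z) \<in> R k"
proof -
  have "(y, z) \<in> (\<Union>i\<le>n. R i)" using scheme by (simp add: symmetric_scheme_def)
  then show ?thesis by blast
qed

lemma relation_unique: "i = j" if "i \<le> n" "j \<le> n" "p \<in> R i" "p \<in> R j"
proof -
  have "disjoint_family_on R {..n}" using scheme by (simp add: symmetric_scheme_def)
  then show ?thesis using that unfolding disjoint_family_on_def by blast
qed

lemma relation_sym: "(z, y) \<in> R k" if "k \<le> n" "(y, z) \<in> R k"
proof -
  have "sym (R k)" using scheme that(1) by (simp add: symmetric_scheme_def)
  then show ?thesis using that(2) by (rule symD)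
qed

lemma sum_adjacency_nth:
  assumes "k \<le> n" "(y, z) \<in> R k"
  shows "(\<Sum>i\<le>n. c i *\<^sub>m adjacency_matrix (R i)) $ y $ z = c k"
proof -
  have iff: "(y, z) \<in> R i \<longleftrightarrow> i = k" if "i \<le> n" for i
    using relation_unique[of i k "(y, z)"] assms that by auto
  have "(\<Sum>i\<le>n. c i *\<^sub>m adjacency_matrix (R i)) $ y $ z
      = (\<Sum>i\<le>n. c i * (if (y, z) \<in> R i then 1 else 0))"
    by (simp only: sum_component matrix_scale_nth adjacency_matrix_nth)
  also have "\<dots> = (\<Sum>i\<le>n. if i = k then c i else 0)"
    by (intro sum.cong refl) (simp add: iff)
  also have "\<dots> = c k" using assms(1) by simp
  finally show ?thesis .
qed

text \<open>The relations partition all pairs, so the coefficient of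
  \<open>adjacency_matrix (R k)\<close> is the common entry on \<open>R k\<close>. Closure
  properties thereby become statements about entries.\<close>

lemma adjacency_algebra_iff:
  "M \<in> \<A> \<longleftrightarrow> (\<exists>f. \<forall>k\<le>n. \<forall>y z. (y, z) \<in> R k \<longrightarrow> M $ y $ z = f k)"
proof
  assume "M \<in> \<A>"
  then obtain c where "M = (\<Sum>i\<le>n. c i *\<^sub>m adjacency_matrix (R i))"
    by (auto simp: adjacency_algebra_def)
  then show "\<exists>f. \<forall>k\<le>n. \<forall>y z. (y, z) \<in> R k \<longrightarrow> M $ y $ z = f k"
    using sum_adjacency_nth by blast
next
  assume "\<exists>f. \<forall>k\<le>n. \<forall>y z. (y, z) \<in> R k \<longrightarrow> M $ y $ z = f k"
  then obtain f where f: "\<And>k y z. k \<le> n \<Longrightarrow> (y, z) \<in> R k \<Longrightarrow> M $ y $ z = f k" by blast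
  have "M $ y $ z = (\<Sum>i\<le>n. f i *\<^sub>m adjacency_matrix (R i)) $ y $ z" for y z
    using ex_relation[of y z] f sum_adjacency_nth by metis
  then have "M = (\<Sum>i\<le>n. f i *\<^sub>m adjacency_matrix (R i))"
    by (simp add: vec_eq_iff)
  then show "M \<in> \<A>" by (auto simp: adjacency_algebra_def)
qed

lemma adjacency_algebra_diff: "M - N \<in> \<A>" if "M \<in> \<A>" "N \<in> \<A>"
proof -
  from that obtain f g where
    "\<forall>k\<le>n. \<forall>y z. (y, z) \<in> R k \<longrightarrow> M $ y $ z = f k"
    "\<forall>k\<le>n. \<forall>y z. (y, z) \<in> R k \<longrightarrow> N $ y $ z = g k"
    by (auto simp: adjacency_algebra_iff)
  then show ?thesis
    unfolding adjacency_algebra_iff by (intro exI[of _ "\<lambda>k. f k - g k"]) simp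
qed

lemma adjacency_algebra_entrywise: "M \<circ>\<^sub>m N \<in> \<A>" if "M \<in> \<A>" "N \<in> \<A>"
proof -
  from that obtain f g where
    "\<forall>k\<le>n. \<forall>y z. (y, z) \<in> R k \<longrightarrow> M $ y $ z = f k"
    "\<forall>k\<le>n. \<forall>y z. (y, z) \<in> R k \<longrightarrow> N $ y $ z = g k"
    by (auto simp: adjacency_algebra_iff)
  then show ?thesis
    unfolding adjacency_algebra_iff by (intro exI[of _ "\<lambda>k. f k * g k"]) simp
qed

lemma adjacency_algebra_conj: "conj_matrix M \<in> \<A>" if "M \<in> \<A>"
proof -
  from that obtain f where "\<forall>k\<le>n. \<forall>y z. (y, z) \<in> R k \<longrightarrow> M $ y $ z = f k"
    by (auto simp: adjacency_algebra_iff)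
  then show ?thesis
    unfolding adjacency_algebra_iff by (intro exI[of _ "\<lambda>k. cnj (f k)"]) simp
qed

lemma adjacency_algebra_sym: "M $ y $ z = M $ z $ y" if "M \<in> \<A>"
proof -
  from that obtain f where "\<And>k y z. k \<le> n \<Longrightarrow> (y, z) \<in> R k \<Longrightarrow> M $ y $ z = f k"
    by (auto simp: adjacency_algebra_iff)
  then show ?thesis using ex_relation[of y z] relation_sym by metis
qed

lemma adjacency_matrix_in: "adjacency_matrix (R k) \<in> \<A>" if "k \<le> n"
  unfolding adjacency_algebra_iff
proof (intro exI[of _ "\<lambda>i. if i = k then 1 else 0"] allI impI)
  fix i y z assume i: "i \<le> n" "(y, z) \<in> R i"
  then have "(y, z) \<in> R k \<longleftrightarrow> i = k" using that relation_unique[of i k "(y, z)"] by auto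
  then show "adjacency_matrix (R k) $ y $ z = (if i = k then 1 else 0)" by simp
qed

lemma mat_1_in: "mat 1 \<in> \<A>"
proof -
  have "adjacency_matrix (R 0) = mat 1"
    using scheme by (auto simp: vec_eq_iff mat_def symmetric_scheme_def)
  then show ?thesis using adjacency_matrix_in[of 0] by simp
qed

text \<open>Grouping the middle points \<open>w\<close> by the relations of \<open>(y, w)\<close>
  and \<open>(w, z)\<close> expresses each entry of the product through the intersection numbers,
  which depend only on the relation of \<open>(y, z)\<close>.\<close>

lemma adjacency_algebra_mult: "M ** N \<in> \<A>" if "M \<in> \<A>" "N \<in> \<A>"
proof -
  from that obtain f g where
    f: "\<And>k y z. k \<le> n \<Longrightarrow> (y, z) \<in> R k \<Longrightarrow> M $ y $ z = f k" and
    g: "\<And>k y z. k \<le> n \<Longrightarrow> (y, z) \<in> R k \<Longrightarrow> N $ y $ z = g k"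
    unfolding adjacency_algebra_iff by metis
  obtain p :: "nat \<Rightarrow> nat \<Rightarrow> nat \<Rightarrow> nat" where
    "\<forall>i\<le>n. \<forall>j\<le>n. \<forall>k\<le>n. \<forall>(y, z) \<in> R k. card {w. (y, w) \<in> R i \<and> (w, z) \<in> R j} = p i j k"
    using scheme by (auto simp: symmetric_scheme_def)
  then have p: "\<forall>(y, z) \<in> R k. card {w. (y, w) \<in> R i \<and> (w, z) \<in> R j} = p i j k"
    if "i \<le> n" "j \<le> n" "k \<le> n" for i j k
    using that by simp
  \<comment> \<open>\<open>r y z\<close> is the index of the one relation containing
    \<open>(y, z)\<close>; it labels the groups.\<close>
  obtain r where r: "\<And>y z. r y z \<le> n \<and> (y, z) \<in> R (r y z)"
    using ex_relation by metis
  have r_iff: "r y z = i \<longleftrightarrow> (y, z) \<in> R i" if "i \<le> n" for y z i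
    using r[of y z] relation_unique[of "r y z" i "(y, z)"] that by auto
  have "(M ** N) $ y $ z = (\<Sum>(i, j)\<in>{..n} \<times> {..n}. f i * g j * of_nat (p i j k))"
    if k: "k \<le> n" "(y, z) \<in> R k" for k y z
  proof -
    have inner: "(\<Sum>w\<in>{w \<in> UNIV. (r y w, r w z) = (i, j)}. f (r y w) * g (r w z))
        = f i * g j * of_nat (p i j k)" if ij: "i \<le> n" "j \<le> n" for i j
    proof -
      have eq: "{w \<in> UNIV. (r y w, r w z) = (i, j)} = {w. (y, w) \<in> R i \<and> (w, z) \<in> R j}"
        using ij by (auto simp: r_iff)
      have "(\<Sum>w\<in>{w \<in> UNIV. (r y w, r w z) = (i, j)}. f (r y w) * g (r w z))
          = (\<Sum>w\<in>{w \<in> UNIV. (r y w, r w z) = (i, j)}. f i * g j)"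
        by (intro sum.cong) auto
      also have "\<dots> = f i * g j * of_nat (p i j k)"
        unfolding eq using p[OF ij k(1)] k(2) by auto
      finally show ?thesis .
    qed
    have "(M ** N) $ y $ z = (\<Sum>w\<in>UNIV. f (r y w) * g (r w z))"
      unfolding matrix_mult_nth using r f g by (intro sum.cong) metis+
    also have "\<dots> = (\<Sum>q\<in>{..n} \<times> {..n}. \<Sum>w\<in>{w \<in> UNIV. (r y w, r w z) = q}. f (r y w) * g (r w z))"
      by (rule sum.group[symmetric]) (use r in auto)
    also have "\<dots> = (\<Sum>(i, j)\<in>{..n} \<times> {..n}. f i * g j * of_nat (p i j k))"
      by (intro sum.cong refl) (auto simp only: prod.case mem_Times_iff fst_conv snd_conv atMost_iff inner split: prod.split)
    finally show ?thesis .
  qed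
  then show ?thesis
    unfolding adjacency_algebra_iff
    by (intro exI[of _ "\<lambda>k. \<Sum>(i, j)\<in>{..n} \<times> {..n}. f i * g j * of_nat (p i j k)"]) blast
qed

text \<open>All matrices in the algebra are symmetric, so transposing a product reverses it.\<close>

lemma adjacency_algebra_commute: "M ** N = N ** M" if "M \<in> \<A>" "N \<in> \<A>"
proof -
  have "(M ** N) $ y $ z = (N ** M) $ y $ z" for y z
  proof -
    have "(M ** N) $ y $ z = (M ** N) $ z $ y"
      using that adjacency_algebra_mult adjacency_algebra_sym by blast
    also have "\<dots> = (N ** M) $ y $ z"
      unfolding matrix_mult_nth
      using adjacency_algebra_sym[OF that(1)] adjacency_algebra_sym[OF that(2)]
      by (intro sum.cong) (metis mult.commute)+
    finally show ?thesis .
  qed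
  then show ?thesis by (simp add: vec_eq_iff)
qed

section \<open>Primitive idempotents as a basis\<close>

lemma primitive: "primitive_idempotent \<A> (E i)" if "i \<le> n"
  using ordering that unfolding idempotent_ordering_def bij_betw_def by auto

lemma E_in: "E i \<in> \<A>" if "i \<le> n"
  using primitive[OF that] by (simp add: primitive_idempotent_def)

lemma E_nonzero: "E i \<noteq> 0" if "i \<le> n"
  using primitive[OF that] by (simp add: primitive_idempotent_def)

lemma E_idem: "E i ** E i = E i" if "i \<le> n"
  using primitive[OF that] by (simp add: primitive_idempotent_def)

lemma E_inj: "inj_on E {..n}"
  using ordering by (simp add: idempotent_ordering_def bij_betw_def)

lemma E_0_nth: "E 0 $ y $ z = 1 / of_nat CARD('v)"
  using ordering by (simp add: idempotent_ordering_def)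

text \<open>If \<open>e f\<close> were neither \<open>0\<close> nor \<open>e\<close>, then \<open>e = e f + (e - e f)\<close> would split \<open>e\<close>.\<close>

lemma primitive_mult:
  assumes e: "primitive_idempotent \<A> e" and f: "f \<in> \<A>" "f ** f = f"
  shows "e ** f = 0 \<or> e ** f = e"
proof (rule ccontr)
  assume contra: "\<not> ?thesis"
  have e': "e \<in> \<A>" "e ** e = e" using e by (auto simp: primitive_idempotent_def)
  let ?g = "e ** f"
  have comm: "e ** f = f ** e" using e' f adjacency_algebra_commute by blast
  have gg: "?g ** ?g = ?g"
    by (metis comm e'(2) f(2) matrix_mul_assoc)
  have eg: "e ** ?g = ?g" "?g ** e = ?g"
    by (metis comm e'(2) matrix_mul_assoc)+
  have "?g \<in> \<A>" "e - ?g \<in> \<A>"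
    using e' f adjacency_algebra_mult adjacency_algebra_diff by blast+
  moreover have "?g \<noteq> 0" "e - ?g \<noteq> 0" using contra by auto
  moreover have "(e - ?g) ** (e - ?g) = e - ?g" "?g ** (e - ?g) = 0" "(e - ?g) ** ?g = 0"
    by (simp_all only: matrix_diff_ldistrib matrix_diff_rdistrib eg gg e' diff_self diff_zero)
  moreover have "e = ?g + (e - ?g)" by simp
  ultimately show False
    using e gg unfolding primitive_idempotent_def by blast
qed

text \<open>By primitivity a nonzero product equals each of its two commuting factors, which would
  then coincide.\<close>

lemma E_orthogonal: "E i ** E j = 0" if "i \<le> n" "j \<le> n" "i \<noteq> j"
proof (rule ccontr)
  assume nz: "E i ** E j \<noteq> 0"
  have comm: "E i ** E j = E j ** E i" using E_in that adjacency_algebra_commute by blast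
  have "E i ** E j = E i" using nz primitive_mult[OF primitive E_in E_idem] that by blast
  moreover have "E j ** E i = E j"
    using nz primitive_mult[OF primitive E_in E_idem, of j i] that comm by auto
  ultimately have "E i = E j" using comm by simp
  then show False using E_inj that by (auto dest: inj_onD)
qed

lemma E_mult_sum: "E i ** (\<Sum>j\<le>n. c j *\<^sub>m E j) = c i *\<^sub>m E i" if "i \<le> n"
proof -
  have "E i ** (\<Sum>j\<le>n. c j *\<^sub>m E j) = (\<Sum>j\<le>n. if j = i then c j *\<^sub>m E j else 0)"
    unfolding matrix_mult_sum_right matrix_scale_mult_right
    using that by (intro sum.cong) (auto simp: E_idem E_orthogonal)
  then show ?thesis using that by simp
qed

text \<open>There are \<open>n + 1\<close> orthogonal idempotents in a space spanned by \<open>n + 1\<close> matrices.\<close>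

lemma E_spans:
  assumes "M \<in> \<A>"
  obtains c where "M = (\<Sum>j\<le>n. c j *\<^sub>m E j)"
proof -
  let ?B = "(\<lambda>i. adjacency_matrix (R i)) ` {..n}"
  have A_span: "\<A> \<subseteq> mat.span ?B"
    unfolding adjacency_algebra_def
    by (auto intro!: mat.span_sum intro: mat.span_scale mat.span_base)
  have indep: "mat.independent (E ` {..n})"
  proof (rule mat.independent_if_scalars_zero)
    fix f e assume 0: "(\<Sum>e\<in>E ` {..n}. f e *\<^sub>m e) = 0" and "e \<in> E ` {..n}"
    then obtain i where i: "i \<le> n" "e = E i" by auto
    have "(\<Sum>j\<le>n. f (E j) *\<^sub>m E j) = 0"
      using 0 by (simp only: sum.reindex[OF E_inj] o_def)
    then have "f (E i) *\<^sub>m E i = 0"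
      using E_mult_sum[OF i(1), of "\<lambda>j. f (E j)"] by simp
    then show "f e = 0" using E_nonzero[OF i(1)] i(2) by simp
  qed simp
  have "M \<in> mat.span (E ` {..n})"
  proof (rule ccontr)
    assume no: "M \<notin> mat.span (E ` {..n})"
    then have "mat.independent (insert M (E ` {..n}))"
      using indep by (simp add: mat.independent_insert)
    moreover have "insert M (E ` {..n}) \<subseteq> mat.span ?B"
      using assms E_in A_span by blast
    ultimately have "card (insert M (E ` {..n})) \<le> card ?B"
      using mat.independent_span_bound by blast
    also have "\<dots> \<le> n + 1" using card_image_le[of "{..n}"] by force
    finally have "card (insert M (E ` {..n})) \<le> n + 1" .
    moreover have "M \<notin> E ` {..n}" using no mat.span_base[of M "E ` {..n}"] by blast
    then have "card (insert M (E ` {..n})) = n + 2"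
      by (simp add: card_image[OF E_inj] card_insert_disjoint)
    ultimately show False by linarith
  qed
  then obtain u where "M = (\<Sum>e\<in>E ` {..n}. u e *\<^sub>m e)"
    using mat.span_finite[of "E ` {..n}"] by auto
  then have "M = (\<Sum>j\<le>n. u (E j) *\<^sub>m E j)"
    by (simp only: sum.reindex[OF E_inj] o_def)
  then show thesis by (rule that)
qed

text \<open>Multiplication by \<open>E i\<close> keeps only the coefficient of \<open>E i\<close> in
  the expansion of \<open>M\<close>, so the algebra acts on the range of \<open>E i\<close> by
  scalars.\<close>

lemma E_mult_algebra:
  assumes "i \<le> n" "M \<in> \<A>"
  obtains c where "E i ** M = c *\<^sub>m E i"
proof -
  obtain c where "M = (\<Sum>j\<le>n. c j *\<^sub>m E j)" using E_spans[OF assms(2)] .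
  then show thesis using E_mult_sum[OF assms(1), of c] that[of "c i"] by simp
qed

text \<open>Multiplying the expansion of the identity by \<open>E i\<close> shows that each
  coefficient is 1.\<close>

lemma sum_E: "(\<Sum>j\<le>n. E j) = mat 1"
proof -
  obtain c where c: "mat 1 = (\<Sum>j\<le>n. c j *\<^sub>m E j)" using E_spans[OF mat_1_in] .
  have "c i = 1" if i: "i \<le> n" for i
  proof -
    have "c i *\<^sub>m E i = 1 *\<^sub>m E i" using E_mult_sum[OF i, of c] c
      by (metis matrix_mul_rid mat.scale_one)
    then show ?thesis using E_nonzero[OF i] by (metis mat.scale_right_imp_eq)
  qed
  then have "(\<Sum>j\<le>n. c j *\<^sub>m E j) = (\<Sum>j\<le>n. E j)" by (intro sum.cong) simp_all
  then show ?thesis using c by simp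
qed

lemma E_decomp: "v = (\<Sum>j\<le>n. E j *v v)"
  by (simp only: sum_matrix_vector[symmetric] sum_E matrix_vector_mul_lid)

text \<open>The entries of \<open>E i ** conj_matrix (E i)\<close> on the diagonal are sums of squares, so this
  product is nonzero and by primitivity equals \<open>E i\<close>; conjugating, it also equals \<open>conj_matrix (E i)\<close>.\<close>

lemma E_real:
  assumes "i \<le> n"
  shows "cnj (E i $ y $ z) = E i $ y $ z"
proof -
  let ?C = "conj_matrix (E i)"
  have C: "?C \<in> \<A>" using adjacency_algebra_conj E_in assms by blast
  have comm: "E i ** ?C = ?C ** E i"
    using C E_in assms adjacency_algebra_commute by blast
  have CC: "?C ** ?C = ?C" by (simp flip: conj_matrix_mult add: E_idem assms)
  have "E i ** ?C \<noteq> 0"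
  proof
    assume 0: "E i ** ?C = 0"
    have "E i $ a $ b = 0" for a b
    proof -
      have "0 = (E i ** ?C) $ a $ a" using 0 by simp
      also have "\<dots> = (\<Sum>w\<in>UNIV. E i $ a $ w * cnj (E i $ a $ w))"
        unfolding matrix_mult_nth using adjacency_algebra_sym[OF E_in[OF assms]]
        by (intro sum.cong refl) (metis conj_matrix_nth)
      also have "\<dots> = of_real (\<Sum>w\<in>UNIV. (cmod (E i $ a $ w))\<^sup>2)"
        by (simp add: complex_norm_square del: of_real_power)
      finally have "(\<Sum>w\<in>UNIV. (cmod (E i $ a $ w))\<^sup>2) = 0"
        by (metis of_real_eq_0_iff)
      then show ?thesis by (simp add: sum_nonneg_eq_0_iff)
    qed
    then show False using E_nonzero[OF assms] by (simp add: vec_eq_iff)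
  qed
  then have "E i ** ?C = E i"
    using primitive_mult[OF primitive[OF assms] C CC] by blast
  moreover from this have "?C ** E i = ?C"
    using conj_matrix_mult[of "E i" ?C] by simp
  ultimately have "?C = E i" using comm by simp
  then show ?thesis by (metis conj_matrix_nth)
qed

section \<open>Vanishing triple products\<close>

text \<open>Summing the squared norms of \<open>E i D E j\<close> over all base points \<open>x\<close>, where \<open>D\<close> is the
  diagonal matrix with entries \<open>E k $ x $ w\<close>, gives the trace of \<open>(E k \<circ>\<^sub>m E j) ** E i\<close>.\<close>

lemma triple_product_zero:
  assumes ijk: "i \<le> n" "j \<le> n" "k \<le> n" and 0: "(E k \<circ>\<^sub>m E j) ** E i = 0"
  shows "E i *v diag_mult (\<lambda>w. E k $ x $ w) (E j *v v) = 0"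
proof -
  define T where "T x y z = (\<Sum>w\<in>UNIV. E i $ y $ w * E k $ x $ w * E j $ w $ z)" for x y z
  have sym: "E a $ p $ q = E a $ q $ p" if "a \<le> n" for a p q
    using adjacency_algebra_sym E_in that by blast
  have idem: "(\<Sum>y\<in>UNIV. E a $ p $ y * E a $ y $ q) = E a $ p $ q" if "a \<le> n" for a p q
    using E_idem[OF that] by (metis matrix_mult_nth)
  \<comment> \<open>As \<open>T\<close> is real, its squares are squared moduli, and a zero total
    forces every \<open>T x y z\<close> to vanish.\<close>
  have cnj_T: "cnj (T x y z) = T x y z" for x y z
    unfolding T_def using ijk by (simp add: E_real)
  have "(\<Sum>x\<in>UNIV. \<Sum>y\<in>UNIV. \<Sum>z\<in>UNIV. T x y z * T x y z)
      = (\<Sum>x\<in>UNIV. \<Sum>y\<in>UNIV. \<Sum>z\<in>UNIV. \<Sum>w\<in>UNIV. \<Sum>w'\<in>UNIV.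
          (E k $ w $ x * E k $ x $ w') * ((E i $ w $ y * E i $ y $ w') * (E j $ w $ z * E j $ z $ w')))"
    unfolding T_def sum_product
  proof (intro sum.cong refl)
    fix x y z w w'
    show "E i $ y $ w * E k $ x $ w * E j $ w $ z * (E i $ y $ w' * E k $ x $ w' * E j $ w' $ z)
        = (E k $ w $ x * E k $ x $ w') * ((E i $ w $ y * E i $ y $ w') * (E j $ w $ z * E j $ z $ w'))"
      unfolding sym[OF ijk(1), of w y] sym[OF ijk(3), of w x] sym[OF ijk(2), of z w']
      by (simp only: mult_ac)
  qed
  also have "\<dots> = (\<Sum>w\<in>UNIV. \<Sum>w'\<in>UNIV. \<Sum>x\<in>UNIV. \<Sum>y\<in>UNIV. \<Sum>z\<in>UNIV.
          (E k $ w $ x * E k $ x $ w') * ((E i $ w $ y * E i $ y $ w') * (E j $ w $ z * E j $ z $ w')))"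
    by (rule sum_rotate5)
  also have "\<dots> = (\<Sum>w\<in>UNIV. \<Sum>w'\<in>UNIV. E k $ w $ w' * (E i $ w $ w' * E j $ w $ w'))"
    by (simp only: sum_distrib_left[symmetric] sum_distrib_right[symmetric] idem ijk)
  also have "\<dots> = (\<Sum>w\<in>UNIV. ((E k \<circ>\<^sub>m E j) ** E i) $ w $ w)"
    unfolding matrix_mult_nth using sym[OF ijk(1)]
    by (intro sum.cong refl) (simp add: mult_ac)
  also have "\<dots> = 0" by (simp add: 0)
  finally have "(\<Sum>x\<in>UNIV. \<Sum>y\<in>UNIV. \<Sum>z\<in>UNIV. T x y z * cnj (T x y z)) = 0"
    by (simp add: cnj_T)
  then have "complex_of_real (\<Sum>x\<in>UNIV. \<Sum>y\<in>UNIV. \<Sum>z\<in>UNIV. (cmod (T x y z))\<^sup>2) = 0"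
    by (simp add: complex_norm_square del: of_real_power)
  then have "(\<Sum>x\<in>UNIV. \<Sum>y\<in>UNIV. \<Sum>z\<in>UNIV. (cmod (T x y z))\<^sup>2) = 0"
    by (metis of_real_eq_0_iff)
  then have T0: "T x y z = 0" for y z
    by (simp add: sum_nonneg_eq_0_iff sum_nonneg)
  have "(E i *v diag_mult (\<lambda>w. E k $ x $ w) (E j *v v)) $ y = (\<Sum>z\<in>UNIV. T x y z * v $ z)" for y
    unfolding T_def sum_distrib_right matrix_vector_mult_def
    by (simp add: sum_distrib_left) (subst sum.swap, simp add: mult_ac)
  then show ?thesis by (simp add: vec_eq_iff T0)
qed

end

section \<open>The recurrence and separation of shells\<close>

text \<open>For \<open>n = 0\<close> the matrix \<open>E 1\<close> is not one of the idempotents.\<close>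

locale Q_polynomial_scheme = idempotent_ordered_scheme n R E
  for n and R :: "nat \<Rightarrow> ('v::finite \<times> 'v) set" and E :: "nat \<Rightarrow> complex^'v^'v" +
  assumes Q_poly: "Q_polynomial n E" and n_pos: "0 < n"
begin

text \<open>Natural-number form with the factor 1/|X| absorbed. The indices are shifted:
  \<open>b i\<close> and \<open>c i\<close> here come from the coefficients with indices
  \<open>i - 1\<close> and \<open>i + 1\<close>. The case distinctions replace the zero matrices at
  both ends.\<close>

lemma three_term_recurrence:
  obtains a b c :: "nat \<Rightarrow> complex" where
    "\<And>i. i < n \<Longrightarrow> c i \<noteq> 0"
    "\<And>i. i \<le> n \<Longrightarrow> E 1 \<circ>\<^sub>m E i = b i *\<^sub>m (if i = 0 then 0 else E (i - 1)) + a i *\<^sub>m E i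
       + c i *\<^sub>m (if i = n then 0 else E (i + 1))"
proof -
  let ?F = "extended_idempotent n E"
  obtain a b c :: "int \<Rightarrow> real" where
    nz: "\<forall>i\<in>{1..int n}. b (i - 1) * c i \<noteq> 0" and
    rec: "\<forall>i\<in>{0..int n}. ?F 1 \<circ>\<^sub>m ?F i =
           (1 / of_nat CARD('v)) *\<^sub>m
             (of_real (b (i - 1)) *\<^sub>m ?F (i - 1) + of_real (a i) *\<^sub>m ?F i
              + of_real (c (i + 1)) *\<^sub>m ?F (i + 1))"
    using Q_poly unfolding Q_polynomial_def Let_def by metis
  let ?s = "1 / of_nat CARD('v) :: complex"
  show thesis
  proof (rule that[of "\<lambda>i. ?s * of_real (c (int i + 1))" "\<lambda>i. ?s * of_real (b (int i - 1))"
        "\<lambda>i. ?s * of_real (a (int i))"])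
    fix i assume "i < n"
    then show "?s * of_real (c (int i + 1)) \<noteq> 0" using nz[rule_format, of "int i + 1"] by simp
  next
    fix i assume i: "i \<le> n"
    have F: "?F 1 = E 1" "?F (int i) = E i" "?F (int i - 1) = (if i = 0 then 0 else E (i - 1))"
      "?F (int i + 1) = (if i = n then 0 else E (i + 1))"
      using i n_pos by (auto simp: extended_idempotent_def nat_diff_distrib nat_add_distrib)
    show "E 1 \<circ>\<^sub>m E i = (?s * of_real (b (int i - 1))) *\<^sub>m (if i = 0 then 0 else E (i - 1))
        + (?s * of_real (a (int i))) *\<^sub>m E i
        + (?s * of_real (c (int i + 1))) *\<^sub>m (if i = n then 0 else E (i + 1))"
      using rec[rule_format, of "int i"] i unfolding F
      by (simp only: mat.scale_right_distrib mat.scale_scale) auto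
  qed
qed

text \<open>\<open>E 1 \<circ>\<^sub>m E j\<close> involves only idempotents of index at least
  \<open>j - 1\<close>, all orthogonal to \<open>E i\<close>.\<close>

lemma entrywise_mult_zero: "(E 1 \<circ>\<^sub>m E j) ** E i = 0" if "i + 1 < j" "j \<le> n"
proof -
  obtain a b c where "\<And>i. i \<le> n \<Longrightarrow>
      E 1 \<circ>\<^sub>m E i = b i *\<^sub>m (if i = 0 then 0 else E (i - 1)) + a i *\<^sub>m E i
       + c i *\<^sub>m (if i = n then 0 else E (i + 1))"
    using three_term_recurrence by metis
  with that show ?thesis
    by (auto simp: matrix_add_rdistrib matrix_scale_mult_left E_orthogonal)
qed

text \<open>Since \<open>c k\<close> is nonzero for \<open>k < n\<close>, the recurrence can be
  solved for its highest term; induction starts from the constant matrix \<open>E 0\<close>.\<close>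

lemma E_determined_by_E_1:
  assumes "E 1 $ x $ y = E 1 $ x $ z" "i \<le> n"
  shows "E i $ x $ y = E i $ x $ z"
  using assms(2)
proof (induction i rule: less_induct)
  case (less i)
  obtain a b c where nz: "\<And>i. i < n \<Longrightarrow> c i \<noteq> 0" and
    rec: "\<And>i. i \<le> n \<Longrightarrow> E 1 \<circ>\<^sub>m E i = b i *\<^sub>m (if i = 0 then 0 else E (i - 1)) + a i *\<^sub>m E i
       + c i *\<^sub>m (if i = n then 0 else E (i + 1))"
    using three_term_recurrence by metis
  show ?case
  proof (cases i)
    case 0
    then show ?thesis by (simp add: E_0_nth)
  next
    case (Suc k)
    then have k: "k < n" using less.prems by simp
    have step: "c k * E i $ x $ w = E 1 $ x $ w * E k $ x $ w
        - b k * (if k = 0 then 0 else E (k - 1) $ x $ w) - a k * E k $ x $ w" for w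
      using arg_cong[OF rec[of k], of "\<lambda>M. M $ x $ w"] k Suc by (simp split: if_splits)
    have IH: "E j $ x $ y = E j $ x $ z" if "j < i" for j
      using less that by simp
    have "c k * E i $ x $ y = c k * E i $ x $ z"
      unfolding step assms(1) using Suc IH[of k] IH[of "k - 1"] by simp
    then show ?thesis using nz[OF k] by simp
  qed
qed

text \<open>\<open>adjacency_matrix (R k)\<close> is a combination of the idempotents, none of which
  distinguishes \<open>y\<close> from \<open>z\<close> in row \<open>x\<close>.\<close>

lemma E_1_separates_shells:
  assumes "E 1 $ x $ y = E 1 $ x $ z" "k \<le> n" "(x, y) \<in> R k"
  shows "(x, z) \<in> R k"
proof -
  obtain c where "adjacency_matrix (R k) = (\<Sum>j\<le>n. c j *\<^sub>m E j)"
    using E_spans adjacency_matrix_in assms(2) by blast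
  then have "adjacency_matrix (R k) $ x $ y = adjacency_matrix (R k) $ x $ z"
    using E_determined_by_E_1[OF assms(1)] by (simp add: sum_component)
  then show ?thesis using assms(3) by (simp split: if_splits)
qed

section \<open>Multiplication and the span conditions\<close>

text \<open>The span conditions of a relative design for arbitrary complex vectors, because
  multiplication by \<open>E 1 $ x $ y - \<theta>\<close> does not preserve nonnegativity. Index 0
  is included since it occurs among the terms \<open>E j *v v\<close> of the decomposition.\<close>

definition shell_aligned :: "'v \<Rightarrow> int \<Rightarrow> complex^'v \<Rightarrow> bool" where
  "shell_aligned x s v \<longleftrightarrow> (\<forall>i\<le>n. int i \<le> s \<longrightarrow> E i *v v \<in> vec.span {E i *v axis x 1})"

lemma E_0_span: "E 0 *v v \<in> vec.span {E 0 *v axis x 1}"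
proof -
  have "E 0 *v v = (\<Sum>y\<in>UNIV. v $ y) *s (E 0 *v axis x 1)"
    by (simp add: vec_eq_iff matrix_vector_mult_def E_0_nth axis_def sum_divide_distrib
        if_distrib cong: if_cong)
  then show ?thesis by (simp add: vec.span_base vec.span_scale)
qed

text \<open>Split \<open>v\<close> into its components \<open>E j *v v\<close>. Those with
  \<open>j > i + 1\<close> are killed by the triple product. The others satisfy
  \<open>j \<le> s\<close>, so they are multiples of \<open>E j *v axis x 1\<close>, and the algebra
  takes over. The bound \<open>j \<le> i + 1\<close> is why one degree is lost.\<close>

lemma shell_aligned_mult_E_1:
  assumes v: "shell_aligned x s v"
  shows "shell_aligned x (s - 1) (diag_mult (\<lambda>y. E 1 $ x $ y) v)"
  unfolding shell_aligned_def
proof (intro allI impI)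
  fix i assume i: "i \<le> n" "int i \<le> s - 1"
  let ?D = "diag_mult (\<lambda>y. E 1 $ x $ y)"
  let ?S = "vec.span {E i *v axis x 1}"
  have "E i *v ?D (E j *v v) \<in> ?S" if j: "j \<le> n" for j
  proof (cases "i + 1 < j")
    case True
    then have "E i *v ?D (E j *v v) = 0"
      using triple_product_zero entrywise_mult_zero i j n_pos by simp
    then show ?thesis by (simp add: vec.span_zero)
  next
    case False
    then have "E j *v v \<in> vec.span {E j *v axis x 1}"
      using v i j by (simp add: shell_aligned_def)
    then obtain \<alpha> where \<alpha>: "E j *v v = \<alpha> *s (E j *v axis x 1)"
      by (auto simp: vec.span_singleton)
    \<comment> \<open>Applying a matrix to \<open>axis x 1\<close> selects column \<open>x\<close>,
      while \<open>?D\<close> uses row \<open>x\<close> of \<open>E 1\<close>; symmetry identifies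
      the two.\<close>
    have "?D (E j *v v) = \<alpha> *s ((E 1 \<circ>\<^sub>m E j) *v axis x 1)"
      unfolding \<alpha> using adjacency_algebra_sym[OF E_in[of 1]] n_pos
      by (simp add: vec_eq_iff matrix_vector_mult_def axis_def if_distrib cong: if_cong)
    moreover obtain c where "E i ** (E 1 \<circ>\<^sub>m E j) = c *\<^sub>m E i"
      using E_mult_algebra[OF i(1)] adjacency_algebra_entrywise E_in j n_pos
      by (metis One_nat_def Suc_leI)
    ultimately have "E i *v ?D (E j *v v) = (\<alpha> * c) *s (E i *v axis x 1)"
      by (simp add: vec.scale matrix_vector_mul_assoc matrix_scale_vector)
    then show ?thesis by (simp add: vec.span_base vec.span_scale)
  qed
  moreover have "E i *v ?D v = (\<Sum>j\<le>n. E i *v ?D (E j *v v))"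
  proof -
    have "?D v = (\<Sum>j\<le>n. ?D (E j *v v))"
      by (subst E_decomp[of v]) (simp add: vec_eq_iff sum_component sum_distrib_left)
    then show ?thesis by (simp add: vec.sum)
  qed
  ultimately show "E i *v ?D v \<in> ?S" by (auto simp only: atMost_iff intro!: vec.span_sum)
qed

lemma shell_aligned_mult_linear:
  assumes v: "shell_aligned x s v"
  shows "shell_aligned x (s - 1) (diag_mult (\<lambda>y. E 1 $ x $ y - \<theta>) v)"
proof -
  have eq: "diag_mult (\<lambda>y. E 1 $ x $ y - \<theta>) v = diag_mult (\<lambda>y. E 1 $ x $ y) v - \<theta> *s v"
    by (simp add: vec_eq_iff algebra_simps)
  show ?thesis
    using shell_aligned_mult_E_1[OF v] v unfolding eq shell_aligned_def
    by (auto simp: vec.diff vec.scale intro!: vec.span_diff vec.span_scale)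
qed

lemma shell_aligned_mult_prod:
  assumes "shell_aligned x s v" "finite K"
  shows "shell_aligned x (s - int (card K)) (diag_mult (\<lambda>y. \<Prod>m\<in>K. E 1 $ x $ y - \<theta> m) v)"
  using assms(2)
proof (induction K)
  case empty
  have "diag_mult (\<lambda>y. 1) v = v" by (simp add: vec_eq_iff)
  then show ?case using assms(1) by simp
next
  case (insert k K)
  have "diag_mult (\<lambda>y. \<Prod>m\<in>insert k K. E 1 $ x $ y - \<theta> m) v
      = diag_mult (\<lambda>y. E 1 $ x $ y - \<theta> k) (diag_mult (\<lambda>y. \<Prod>m\<in>K. E 1 $ x $ y - \<theta> m) v)"
    using insert.hyps by (simp add: vec_eq_iff)
  then show ?case
    using shell_aligned_mult_linear[OF insert.IH, of "\<theta> k"] insert.hyps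
    by (simp add: algebra_simps)
qed

text \<open>Restriction to one shell is multiplication by the Lagrange interpolation polynomial in
  \<open>E 1 $ x $ y\<close>, which has degree \<open>card L - 1\<close>.\<close>

lemma shell_aligned_restrict:
  assumes v: "shell_aligned x s v" and L: "L \<subseteq> {..n}" "l \<in> L"
    and ne: "\<And>m. m \<in> L \<Longrightarrow> shell R x m \<noteq> {}"
    and supp: "\<And>y. v $ y \<noteq> 0 \<Longrightarrow> \<exists>m\<in>L. y \<in> shell R x m"
  shows "shell_aligned x (s - int (card L) + 1) (dual_idempotent R x l *v v)"
proof -
  have fin: "finite L" using L(1) finite_subset by blast
  \<comment> \<open>\<open>q m\<close> is a sample point of shell \<open>m\<close>, and \<theta>
    records the value of row \<open>x\<close> of \<open>E 1\<close> there.\<close>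
  obtain q where q: "\<And>m. m \<in> L \<Longrightarrow> (x, q m) \<in> R m"
  proof -
    have "\<forall>m. \<exists>y. m \<in> L \<longrightarrow> (x, y) \<in> R m" using ne by (auto simp: shell_def)
    then show thesis using that by metis
  qed
  define \<theta> where "\<theta> m = E 1 $ x $ q m" for m
  obtain f where f: "\<forall>k\<le>n. \<forall>y z. (y, z) \<in> R k \<longrightarrow> E 1 $ y $ z = f k"
    using E_in[of 1] n_pos unfolding adjacency_algebra_iff by auto
  have \<theta>: "E 1 $ x $ y = \<theta> m" if "m \<in> L" "(x, y) \<in> R m" for m y
    using f L(1) that q[OF that(1)] unfolding \<theta>_def by auto
  have distinct: "\<theta> m \<noteq> \<theta> l" if "m \<in> L" "m \<noteq> l" for m
  proof
    assume "\<theta> m = \<theta> l"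
    then have "(x, q l) \<in> R m"
      using E_1_separates_shells[of x "q m" "q l" m] q that(1) L(1) unfolding \<theta>_def by auto
    then show False using relation_unique[of m l "(x, q l)"] q that L by auto
  qed
  define K where "K = L - {l}"
  \<comment> \<open>The Lagrange denominator, nonzero because the values \<open>\<theta> m\<close>
    are distinct.\<close>
  define N where "N = (\<Prod>m\<in>K. \<theta> l - \<theta> m)"
  have N: "N \<noteq> 0" unfolding N_def K_def using fin distinct by force
  have "(dual_idempotent R x l *v v) $ y
      = inverse N * ((\<Prod>m\<in>K. E 1 $ x $ y - \<theta> m) * v $ y)" for y
  proof -
    have lhs: "(dual_idempotent R x l *v v) $ y = (if (x, y) \<in> R l then v $ y else 0)"
      by (simp add: dual_idempotent_nth shell_def)
    show ?thesis
    proof (cases "v $ y = 0")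
      case True
      then show ?thesis using lhs by simp
    next
      case False
      then obtain m where m: "m \<in> L" "(x, y) \<in> R m" using supp by (auto simp: shell_def)
      show ?thesis
      proof (cases "m = l")
        case True
        then show ?thesis using lhs m \<theta> N by (simp add: N_def)
      next
        case False
        then have "(x, y) \<notin> R l" using m L relation_unique[of m l "(x, y)"] by auto
        \<comment> \<open>The factor belonging to the shell of \<open>y\<close> vanishes.\<close>
        moreover have "(\<Prod>m\<in>K. E 1 $ x $ y - \<theta> m) = 0"
          using \<theta>[OF m] m False fin by (auto simp: K_def)
        ultimately show ?thesis using lhs by simp
      qed
    qed
  qed
  then have "dual_idempotent R x l *v v
      = inverse N *s diag_mult (\<lambda>y. \<Prod>m\<in>K. E 1 $ x $ y - \<theta> m) v"
    by (simp add: vec_eq_iff)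
  \<comment> \<open>Removing \<open>l\<close> leaves \<open>card L - 1\<close> linear factors, each
    costing one degree.\<close>
  moreover have "s - int (card L) + 1 = s - int (card K)"
    using fin L(2) card_gt_0_iff[of L] by (auto simp: K_def card_Diff_singleton)
  moreover have "finite K" using fin by (simp add: K_def)
  ultimately show ?thesis
    using shell_aligned_mult_prod[OF v, of K \<theta>] unfolding shell_aligned_def
    by (auto simp: vec.scale intro!: vec.span_scale)
qed

end

section \<open>Weighted subsets and the conclusion\<close>

lemma weighted_subset_shell:
  assumes "weighted_subset Y \<omega>"
  shows "weighted_subset (Y \<inter> shell R x l) (dual_idempotent R x l *v \<omega>)"
  using assms unfolding weighted_subset_def by (auto simp: dual_idempotent_nth)

theorem theorem3p8:
  fixes n t :: nat
    and R :: "nat \<Rightarrow> ('v::finite \<times> 'v) set"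
    and E :: "nat \<Rightarrow> complex^'v^'v"
    and x :: 'v
    and Y :: "'v set"
    and \<omega> :: "complex^'v"
    and L :: "nat set"
  assumes "symmetric_scheme n R"
    and "idempotent_ordering n R E"
    and "Q_polynomial n E"
    and "relative_design n E x (int t) Y \<omega>"
    and "L = supporting_shells n R x Y"
  shows "\<forall>l\<in>L. relative_design n E x (int t - int (card L) + 1)
           (Y \<inter> shell R x l) (dual_idempotent R x l *v \<omega>)"
proof
  fix l assume l: "l \<in> L"
  have w: "weighted_subset Y \<omega>" using assms(4) by (simp add: relative_design_def)
  show "relative_design n E x (int t - int (card L) + 1)
           (Y \<inter> shell R x l) (dual_idempotent R x l *v \<omega>)"
  \<comment> \<open>For \<open>n = 0\<close> there are no span conditions, so only the weights have
    to be checked.\<close>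
  proof (cases "n = 0")
    case True
    then show ?thesis using weighted_subset_shell[OF w] by (simp add: relative_design_def)
  next
    case False
    then interpret Q_polynomial_scheme n R E
      by unfold_locales (use assms in auto)
    have "shell_aligned x (int t) \<omega>"
      unfolding shell_aligned_def
    proof (intro allI impI)
      fix i assume "i \<le> n" "int i \<le> int t"
      then show "E i *v \<omega> \<in> vec.span {E i *v axis x 1}"
        \<comment> \<open>Relative designs impose conditions from index 1 on; index 0 holds for
          every vector.\<close>
        using assms(4) E_0_span by (cases "i = 0") (auto simp: relative_design_def)
    qed
    moreover have "\<exists>m\<in>L. y \<in> shell R x m" if "\<omega> $ y \<noteq> 0" for y
    proof -
      have "\<omega> $ y \<in> nonneg_Reals" "Y = {y. Re (\<omega> $ y) > 0}"
        using w by (auto simp: weighted_subset_def)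
      \<comment> \<open>A nonzero nonnegative real has positive real part, so nonzero weight means
        membership in \<open>Y\<close>.\<close>
      then have "y \<in> Y"
        using that by (auto simp: complex_nonneg_Reals_iff complex_eq_iff)
      then show ?thesis
        using ex_relation[of x y] assms(5) by (auto simp: supporting_shells_def shell_def)
    qed
    ultimately have "shell_aligned x (int t - int (card L) + 1) (dual_idempotent R x l *v \<omega>)"
      using assms(5) l by (intro shell_aligned_restrict) (auto simp: supporting_shells_def)
    then show ?thesis
      using weighted_subset_shell[OF w] by (auto simp: relative_design_def shell_aligned_def)
  qed
qed

end
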